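(* (A) Let $I \subset \widetilde{I} \subset \mathbb{R}$ be intervals containing $0$ as an interior point. Then the following are equivalent for $K : \widetilde{I} \to \mathbb{R}$. (1) $K$ is Lebesgue measurable on $I$ and satisfies $K(x+y) = K(x)K(y)$ whenever $x, y, x+y \in \widetilde{I}$. (2) $K$ is continuous on $I$ and satisfies $K(x+y) = K(x)K(y)$ whenever $x, y, x+y \in \widetilde{I}$. (3) Either $K \equiv 0$ on $\widetilde{I}$, or $K(x) = \exp(\beta x)$ for some $\beta \in \mathbb{R}$ and all $x \in \widetilde{I}$. (B) Suppose instead that $I \subset \widetilde{I} \subset \mathbb{R}$ are intervals containing $1$ as an interior point. Then the following are equivalent for $K : \widetilde{I} \to \mathbb{R}$. (1) $K$ is Lebesgue measurable on $I$ and satisfies $K(xy) = K(x) + K(y)$ whenever $x, y, xy \in \widetilde{I}$. (2) $K$ is continuous on $I$ and satisfies $K(xy) = K(x) + K(y)$ whenever $x, y, xy \in \widetilde{I}$. (3) Either $0 \in \widetilde{I}$ and $K \equiv 0$ on $\widetilde{I}$, or $0 \notin \widetilde{I}$ and $K(x) = \beta \ln(x)$ for some $\beta \in \mathbb{R}$ and all $x \in \widetilde{I}$.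
   Context: "$K$ is Lebesgue measurable (resp. continuous) on $I$" means that the restriction $K|_I$ is Lebesgue measurable (resp. continuous). Intervals may be open, closed, half-open, bounded or unbounded. *)

theory Defs
  imports "HOL-Analysis.Analysis"
begin

end

(* After passing to ln K in part (A) and to K o exp in part (B), both parts concern a function f
   that is additive on an interval J around 0 and measurable near 0.  Some set {|f| <= n} fills most
   of (-d,d), so by a Steinhaus-type argument its differences cover a neighbourhood of 0 and f is
   bounded there.  Subtracting a linear function produces a bounded additive g with g(c) = 0, and the
   doubling map t |-> 2t mod c on [0,c] doubles g; hence g = 0.  Halving carries linearity from a
   neighbourhood of 0 to all of J. *)
theory Submission
  imports Defs
begin

section \<open>Repeated halving inside an interval containing 0\<close>

lemma interval_divide_power2:
  fixes J :: "real set"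
  assumes "is_interval J" "0 \<in> J" "x \<in> J"
  shows "x / 2 ^ n \<in> J"
proof (cases "0 \<le> x")
  case True
  then have "0 \<le> x / 2 ^ n" "x / 2 ^ n \<le> x"
    by (auto simp: divide_le_eq mult_le_cancel_left1)
  then show ?thesis
    by (rule mem_is_interval_1_I[OF assms])
next
  case False
  then have "x \<le> x / 2 ^ n" "x / 2 ^ n \<le> 0"
    by (auto simp: le_divide_eq mult_le_cancel_left2 divide_nonpos_pos)
  then show ?thesis
    by (rule mem_is_interval_1_I[OF assms(1,3,2)])
qed

lemma half_power_small:
  fixes x d :: real
  assumes "0 < d"
  obtains n :: nat where "\<bar>x / 2 ^ n\<bar> < d"
proof -
  obtain n :: nat where "\<bar>x\<bar> / d < 2 ^ n"
    using real_arch_pow[of 2 "\<bar>x\<bar> / d"] by auto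
  then have "\<bar>x / 2 ^ n\<bar> < d"
    using assms by (simp add: field_simps)
  then show ?thesis by (rule that)
qed

section \<open>Large sets on which a measurable function is bounded, and their differences\<close>

lemma measurable_bounded_on_large_subset:
  fixes f :: "real \<Rightarrow> real"
  assumes "0 < \<epsilon>" and S: "S \<in> lmeasurable" and f: "f \<in> borel_measurable (lebesgue_on S)"
  obtains n :: nat where "{x \<in> S. \<bar>f x\<bar> \<le> real n} \<in> lmeasurable"
    and "measure lebesgue S - \<epsilon> < measure lebesgue {x \<in> S. \<bar>f x\<bar> \<le> real n}"
proof -
  define E where "E n = {x \<in> S. \<bar>f x\<bar> \<le> real n}" for n :: nat
  have S': "S \<in> sets lebesgue"
    using S by (rule fmeasurableD)
  have E: "E n \<in> lmeasurable" for n
  proof -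
    have "{x \<in> space (lebesgue_on S). \<bar>f x\<bar> \<le> real n} \<in> sets (lebesgue_on S)"
      using f by measurable
    then have "E n \<in> sets lebesgue"
      using S' by (simp add: E_def sets_restrict_space_iff)
    then show ?thesis
      using S by (rule fmeasurableI2[rotated 2]) (auto simp: E_def)
  qed
  \<comment> \<open>Each value \<open>f x\<close> is a real number, so some natural number bounds
    it. The sets \<open>E n\<close> thus increase to \<open>S\<close>, and continuity from below,
    with \<open>S\<close> of finite measure, makes their measures converge to that of
    \<open>S\<close>.\<close>
  have UE: "(\<Union>n. E n) = S"
    using real_arch_simple by (auto simp: E_def)
  have "range E \<subseteq> sets lebesgue"
    using E by (auto intro: fmeasurableD)
  moreover have "incseq E"
    by (auto simp: E_def incseq_def)
  moreover have "emeasure lebesgue (\<Union>n. E n) \<noteq> \<infinity>"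
    using fmeasurableD2[OF S] by (simp add: UE)
  ultimately have "(\<lambda>n. measure lebesgue (E n)) \<longlonglongrightarrow> measure lebesgue (\<Union>n. E n)"
    by (rule Lim_measure_incseq)
  then have "(\<lambda>n. measure lebesgue (E n)) \<longlonglongrightarrow> measure lebesgue S"
    by (simp only: UE)
  then have "eventually (\<lambda>n. measure lebesgue S - \<epsilon> < measure lebesgue (E n)) sequentially"
    using assms(1) by (intro order_tendstoD(1)) auto
  then obtain n where "measure lebesgue S - \<epsilon> < measure lebesgue (E n)"
    by (auto simp: eventually_sequentially)
  with E show ?thesis
    by (intro that[of n]) (auto simp: E_def)
qed

text \<open>If \<open>t\<close> were not a difference, \<open>E\<close> and its translate by
  \<open>t\<close> would be disjoint, with total measure above 3d. Both lie in one interval of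
  length \<open>2 * d + \<bar>t\<bar>\<close>, which is below 5d/2.\<close>

lemma differences_cover_neighbourhood:
  fixes E :: "real set"
  assumes "E \<subseteq> {-d<..<d}" "E \<in> lmeasurable" "3 * d / 2 < measure lebesgue E" "\<bar>t\<bar> < d / 2"
  shows "\<exists>x\<in>E. \<exists>y\<in>E. t = x - y"
proof (rule ccontr)
  assume "\<not> ?thesis"
  then have disj: "E \<inter> (+) t ` E = {}"
    by force
  have tE: "(+) t ` E \<in> lmeasurable" "measure lebesgue ((+) t ` E) = measure lebesgue E"
    using assms(2) by (auto simp: measurable_translation measure_translation)
  have "2 * measure lebesgue E = measure lebesgue (E \<union> (+) t ` E)"
    using measure_Un3[OF assms(2) tE(1)] disj tE(2) by simp
  also have "\<dots> \<le> measure lebesgue {-d + min 0 t..d + max 0 t}"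
  proof (rule measure_mono_fmeasurable)
    show "E \<union> (+) t ` E \<subseteq> {-d + min 0 t..d + max 0 t}"
      using assms(1) by (force simp: min_def max_def)
    show "E \<union> (+) t ` E \<in> sets lebesgue"
      using assms(2) tE(1) by (intro sets.Un fmeasurableD)
  qed simp
  also have "\<dots> \<le> 2 * d + \<bar>t\<bar>"
    using assms(4) by (auto simp: min_def max_def)
  finally show False
    using assms(3,4) by linarith
qed

section \<open>Additive functions on an interval: boundedness near 0, then linearity\<close>

definition additive_on :: "real set \<Rightarrow> (real \<Rightarrow> real) \<Rightarrow> bool" where
  "additive_on J f \<longleftrightarrow> (\<forall>x\<in>J. \<forall>y\<in>J. x + y \<in> J \<longrightarrow> f (x + y) = f x + f y)"

lemma additive_onD:
  "additive_on J f \<Longrightarrow> x \<in> J \<Longrightarrow> y \<in> J \<Longrightarrow> x + y \<in> J \<Longrightarrow> f (x + y) = f x + f y"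
  by (auto simp: additive_on_def)

lemma additive_on_subset: "additive_on J f \<Longrightarrow> I \<subseteq> J \<Longrightarrow> additive_on I f"
  by (auto simp: additive_on_def)

lemma additive_on_minus:
  assumes "additive_on J f" "0 \<in> J" "x \<in> J" "-x \<in> J"
  shows "f (-x) = - f x"
  using additive_onD[OF assms(1), of 0 0] additive_onD[OF assms(1), of x "-x"] assms(2-4) by simp

text \<open>Each \<open>x / 2 ^ k\<close> lies between 0 and \<open>x\<close>, hence in
  \<open>J\<close>, so additivity applies to two equal halves however lopsided \<open>J\<close> is
  around 0. This later carries a formula valid near 0 to all of \<open>J\<close>.\<close>

lemma additive_on_halving:
  assumes "additive_on J f" "is_interval J" "0 \<in> J" "x \<in> J"
  shows "f x = 2 ^ n * f (x / 2 ^ n)"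
proof (induction n)
  case (Suc n)
  have eq: "x / 2 ^ Suc n + x / 2 ^ Suc n = x / 2 ^ n"
    by (simp add: field_simps)
  have "f (x / 2 ^ Suc n + x / 2 ^ Suc n) = f (x / 2 ^ Suc n) + f (x / 2 ^ Suc n)"
    using interval_divide_power2[OF assms(2-4)] by (intro additive_onD[OF assms(1)]) (simp_all only: eq)
  then have "f (x / 2 ^ n) = 2 * f (x / 2 ^ Suc n)"
    by (simp only: eq mult_2)
  with Suc show ?case
    by simp
qed simp

text \<open>A small \<open>t\<close> is a difference \<open>x - y\<close> of two points at which
  \<open>\<bar>f\<bar>\<close> is at most \<open>n\<close>, so \<open>f t = f x - f y\<close> is at
  most \<open>2 * n\<close> in absolute value.\<close>

lemma additive_on_measurable_bounded:
  assumes "0 < d" "additive_on {-d<..<d} f" "f \<in> borel_measurable (lebesgue_on {-d<..<d})"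
  obtains M where "\<And>t. \<bar>t\<bar> < d / 2 \<Longrightarrow> \<bar>f t\<bar> \<le> M"
proof -
  have S: "{-d<..<d} \<in> lmeasurable" "measure lebesgue {-d<..<d} = 2 * d"
    using lmeasurable_box[of "-d" d] assms(1) by (simp_all add: box_real)
  define E where "E n = {x \<in> {-d<..<d}. \<bar>f x\<bar> \<le> real n}" for n :: nat
  \<comment> \<open>Giving up measure d/2 out of 2d leaves exactly the threshold 3d/2 of the
    difference argument.\<close>
  obtain n where E: "E n \<in> lmeasurable" and "2 * d - d / 2 < measure lebesgue (E n)"
    using measurable_bounded_on_large_subset[OF half_gt_zero[OF assms(1)] S(1) assms(3)]
    unfolding S(2) E_def .
  then have big: "3 * d / 2 < measure lebesgue (E n)"
    by simp
  have "\<bar>f t\<bar> \<le> 2 * real n" if t: "\<bar>t\<bar> < d / 2" for t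
  proof -
    have "E n \<subseteq> {-d<..<d}"
      by (auto simp: E_def)
    from differences_cover_neighbourhood[OF this E big t]
    obtain x y where xy: "x \<in> E n" "y \<in> E n" "t = x - y"
      by blast
    have "t \<in> {-d<..<d}"
      using t assms(1) by auto
    then have "f (y + t) = f y + f t"
      using xy by (intro additive_onD[OF assms(2)]) (auto simp: E_def)
    then have "f x = f y + f t"
      using xy(3) by simp
    with xy(1,2) show ?thesis
      unfolding E_def mem_Collect_eq by linarith
  qed
  then show ?thesis by (rule that)
qed

text \<open>For \<open>s\<close> in \<open>{0..c}\<close>, one of \<open>s + s\<close> and
  \<open>s + s - c\<close> is again in \<open>{0..c}\<close>, and \<open>g\<close> takes the value
  \<open>2 * g s\<close> there because \<open>g c = 0\<close>. A nonzero value would therefore grow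
  beyond \<open>M\<close> under iteration.\<close>

lemma additive_on_bounded_zero:
  assumes "0 < c" "additive_on {-3*c..3*c} g" "g c = 0"
    and bdd: "\<And>t. t \<in> {0..c} \<Longrightarrow> \<bar>g t\<bar> \<le> M" and t: "t \<in> {0..c}"
  shows "g t = 0"
proof -
  \<comment> \<open>The point \<open>s\<close> stays arbitrary in the induction, since the
    hypothesis is applied at the doubled point rather than at \<open>s\<close>.\<close>
  have small: "2 ^ n * \<bar>g s\<bar> \<le> M" if "s \<in> {0..c}" for n s
    using that
  proof (induction n arbitrary: s)
    case 0
    then show ?case using bdd by simp
  next
    case (Suc n)
    have double: "g (s + s) = g s + g s"
      using Suc.prems by (intro additive_onD[OF assms(2)]) auto
    show ?case
    proof (cases "s + s \<le> c")
      case True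
      then have "2 ^ n * \<bar>g (s + s)\<bar> \<le> M"
        using Suc by auto
      then show ?thesis
        unfolding double by (simp add: abs_mult mult_ac flip: mult_2)
    next
      case False
      have "g (s + s - c + c) = g (s + s - c) + g c"
        using Suc.prems assms(1) by (intro additive_onD[OF assms(2)]) auto
      then have "g (s + s - c) = g s + g s"
        using double assms(3) by simp
      moreover have "2 ^ n * \<bar>g (s + s - c)\<bar> \<le> M"
        using False Suc by auto
      ultimately show ?thesis
        by (simp add: abs_mult mult_ac flip: mult_2)
    qed
  qed
  show ?thesis
  proof (rule ccontr)
    assume "g t \<noteq> 0"
    then obtain n :: nat where "M / \<bar>g t\<bar> < 2 ^ n"
      using real_arch_pow[of 2 "M / \<bar>g t\<bar>"] by auto
    with \<open>g t \<noteq> 0\<close> small[OF t, of n] show False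
      by (simp add: field_simps)
  qed
qed

theorem additive_on_measurable_linear:
  assumes J: "is_interval J" and d: "0 < d" "{-d<..<d} \<subseteq> J"
    and add: "additive_on J f" and meas: "f \<in> borel_measurable (lebesgue_on {-d<..<d})"
  obtains \<beta> where "\<And>x. x \<in> J \<Longrightarrow> f x = \<beta> * x"
proof -
  have addd: "additive_on {-d<..<d} f"
    using add d(2) by (rule additive_on_subset)
  obtain M where M: "\<And>t. \<bar>t\<bar> < d / 2 \<Longrightarrow> \<bar>f t\<bar> \<le> M"
    using additive_on_measurable_bounded[OF d(1) addd meas] by blast
  \<comment> \<open>With this choice \<open>{0..c}\<close> lies where the bound \<open>M\<close> on
    \<open>f\<close> holds, and \<open>{-3*c..3*c}\<close> lies inside \<open>{-d<..<d}\<close>,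
    where \<open>f\<close> is additive. The slope \<beta> is then fixed by requiring
    \<open>g c = 0\<close>.\<close>
  define c where "c = d / 4"
  define \<beta> where "\<beta> = f c / c"
  define g where "g t = f t - \<beta> * t" for t
  have c: "0 < c" "d = 4 * c"
    using d(1) by (auto simp: c_def)
  have "additive_on {-d<..<d} g"
    using addd by (auto simp: additive_on_def g_def algebra_simps)
  then have addg: "additive_on {-3*c..3*c} g"
    by (rule additive_on_subset) (use c in auto)
  have bdd: "\<bar>g t\<bar> \<le> M + \<bar>\<beta>\<bar> * c" if "t \<in> {0..c}" for t
  proof -
    have "\<bar>f t\<bar> \<le> M"
      using that c by (intro M) auto
    moreover have "\<bar>\<beta> * t\<bar> \<le> \<bar>\<beta>\<bar> * c"
      using that by (auto simp: abs_mult intro!: mult_left_mono)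
    ultimately show ?thesis
      unfolding g_def by linarith
  qed
  have "g c = 0"
    using c by (simp add: g_def \<beta>_def)
  from additive_on_bounded_zero[OF c(1) addg this bdd]
  have pos: "g t = 0" if "t \<in> {0..c}" for t
    using that by blast
  have near: "f t = \<beta> * t" if "\<bar>t\<bar> < c" for t
  proof (cases "0 \<le> t")
    case True
    then show ?thesis using pos[of t] that by (simp add: g_def)
  next
    case False
    then have "g t = 0"
      using pos[of "-t"] additive_on_minus[OF addg, of t] that by simp
    then show ?thesis by (simp add: g_def)
  qed
  have "f x = \<beta> * x" if "x \<in> J" for x
  proof -
    obtain n :: nat where "\<bar>x / 2 ^ n\<bar> < c"
      using half_power_small[OF c(1)] .
    moreover have "0 \<in> J"
      using d by auto
    ultimately show ?thesis
      using additive_on_halving[OF add J _ that, of n] near[of "x / 2 ^ n"] by simp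
  qed
  then show ?thesis by (rule that)
qed

section \<open>From the exponential and logarithmic equations to additive functions\<close>

lemma interior_real_Ioo:
  fixes x :: real
  assumes "x \<in> interior S"
  obtains d where "0 < d" "{x-d<..<x+d} \<subseteq> S"
proof -
  obtain d where "0 < d" "ball x d \<subseteq> S"
    using assms by (auto simp: mem_interior)
  then show ?thesis
    using that by (simp add: ball_eq_greaterThanLessThan)
qed

lemma interval_sets_lebesgue: "is_interval I \<Longrightarrow> I \<in> sets lebesgue" for I :: "real set"
  using real_interval_borel_measurable by (auto intro: sets_completionI_sets)

lemma borel_measurable_lebesgue_on_subset:
  assumes "f \<in> borel_measurable (lebesgue_on S)" "T \<subseteq> S"
  shows "f \<in> borel_measurable (lebesgue_on T)"
  using measurable_restrict_mono[OF assms] .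

text \<open>If \<open>K 0 = 0\<close>, then \<open>K x = K x * K 0\<close> forces \<open>K\<close>
  to vanish on \<open>J\<close>. Otherwise \<open>K\<close> is positive throughout \<open>J\<close>,
  and \<open>ln\<close> turns the equation into additivity.\<close>

lemma multiplicative_measurable_exp:
  fixes K :: "real \<Rightarrow> real"
  assumes J: "is_interval J" and d: "0 < d" "{-d<..<d} \<subseteq> J"
    and mult: "\<And>x y. \<lbrakk>x \<in> J; y \<in> J; x + y \<in> J\<rbrakk> \<Longrightarrow> K (x + y) = K x * K y"
    and meas: "K \<in> borel_measurable (lebesgue_on {-d<..<d})"
  shows "(\<forall>x\<in>J. K x = 0) \<or> (\<exists>\<beta>. \<forall>x\<in>J. K x = exp (\<beta> * x))"
proof (cases "K 0 = 0")
  case True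
  have "0 \<in> J"
    using d by auto
  then have "\<forall>x\<in>J. K x = 0"
    using mult[of _ 0] True by auto
  then show ?thesis ..
next
  case False
  have "0 \<in> J"
    using d by auto
  have sq: "K (x / 2 ^ n) = K (x / 2 ^ Suc n) ^ 2" if "x \<in> J" for x n
  proof -
    have eq: "x / 2 ^ Suc n + x / 2 ^ Suc n = x / 2 ^ n"
      by (simp add: field_simps)
    have "K (x / 2 ^ Suc n + x / 2 ^ Suc n) = K (x / 2 ^ Suc n) * K (x / 2 ^ Suc n)"
      using interval_divide_power2[OF J \<open>0 \<in> J\<close> that] by (intro mult) (simp_all only: eq)
    then show ?thesis
      by (simp only: eq power2_eq_square)
  qed
  have pos: "0 < K x" if "x \<in> J" for x
  proof -
    \<comment> \<open>Since \<open>-x\<close> may lie outside \<open>J\<close>, a zero at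
      \<open>x\<close> is first moved by halving to a point \<open>y\<close> so close to 0 that
      \<open>-y\<close> is in \<open>J\<close>. Then \<open>K 0 = K y * K (-y)\<close> would
      vanish.\<close>
    have "K x \<noteq> 0"
    proof
      assume "K x = 0"
      then have zero: "K (x / 2 ^ n) = 0" for n
        by (induction n) (use sq[OF that] in auto)
      obtain n :: nat where n: "\<bar>x / 2 ^ n\<bar> < d"
        using half_power_small[OF d(1)] .
      define y where "y = x / 2 ^ n"
      have "y \<in> J" "-y \<in> J"
        using n unfolding y_def[symmetric] by (auto simp: abs_less_iff intro!: subsetD[OF d(2)])
      then have "K (y + - y) = K y * K (- y)"
        using \<open>0 \<in> J\<close> by (intro mult) auto
      with zero[of n] False show False
        by (simp add: y_def)
    qed
    \<comment> \<open>\<open>K x\<close> is the square of \<open>K (x / 2)\<close>.\<close>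
    moreover have "0 \<le> K x"
      using sq[OF that, of 0] by simp
    ultimately show ?thesis by simp
  qed
  have "additive_on J (\<lambda>x. ln (K x))"
    using mult pos by (auto simp: additive_on_def ln_mult_pos)
  moreover have "(\<lambda>x. ln (K x)) \<in> borel_measurable (lebesgue_on {-d<..<d})"
    using meas by measurable
  ultimately obtain \<beta> where "\<And>x. x \<in> J \<Longrightarrow> ln (K x) = \<beta> * x"
    using additive_on_measurable_linear[OF J d] by blast
  then have "\<forall>x\<in>J. K x = exp (\<beta> * x)"
    using pos by (metis exp_ln)
  then show ?thesis by blast
qed

text \<open>Preimages of Lebesgue sets under a continuous map need not be Lebesgue measurable. For
  \<open>exp\<close> they are images under \<open>ln\<close>, and a differentiable map sends
  Lebesgue sets to Lebesgue sets.\<close>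

lemma borel_measurable_lebesgue_on_comp_exp:
  fixes K :: "real \<Rightarrow> real"
  assumes S: "S \<in> sets lebesgue" and T: "T \<in> sets lebesgue" "exp ` T \<subseteq> S"
    and meas: "K \<in> borel_measurable (lebesgue_on S)"
  shows "(\<lambda>u. K (exp u)) \<in> borel_measurable (lebesgue_on T)"
proof (rule measurableI)
  fix B :: "real set" assume B: "B \<in> sets borel"
  have "{x \<in> S. K x \<in> B} \<in> sets lebesgue"
    using measurable_sets[OF meas B] S
    by (simp add: sets_restrict_space_iff vimage_def Int_def conj_commute)
  \<comment> \<open>Cutting down to the positive reals puts the set where \<open>ln\<close> is
    differentiable and inverse to \<open>exp\<close>.\<close>
  moreover have "{0<..} \<in> sets (lebesgue :: real measure)"
    by simp
  ultimately have X: "{x \<in> S. K x \<in> B} \<inter> {0<..} \<in> sets lebesgue"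
    by (rule sets.Int)
  have "ln ` ({x \<in> S. K x \<in> B} \<inter> {0<..}) \<in> sets lebesgue"
    by (intro differentiable_image_in_sets_lebesgue X)
      (auto intro!: differentiable_at_imp_differentiable_on
         real_differentiable_def[THEN iffD2] exI DERIV_ln)
  then have "ln ` ({x \<in> S. K x \<in> B} \<inter> {0<..}) \<inter> T \<in> sets lebesgue"
    using T(1) by (rule sets.Int)
  moreover have "ln ` ({x \<in> S. K x \<in> B} \<inter> {0<..}) \<inter> T = (\<lambda>u. K (exp u)) -` B \<inter> T"
  proof safe
    fix u assume "u \<in> T" "K (exp u) \<in> B"
    then show "u \<in> ln ` ({x \<in> S. K x \<in> B} \<inter> {0<..})"
      using T(2) by (intro image_eqI[of _ _ "exp u"]) auto
  qed simp
  ultimately show "(\<lambda>u. K (exp u)) -` B \<inter> space (lebesgue_on T) \<in> sets (lebesgue_on T)"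
    using T(1) by (simp add: sets_restrict_space_iff)
qed simp

lemma logarithmic_measurable_ln:
  fixes K :: "real \<Rightarrow> real"
  assumes J: "is_interval J" "0 \<notin> J" and I: "I \<in> sets lebesgue" "I \<subseteq> J" "1 \<in> interior I"
    and mult: "\<And>x y. \<lbrakk>x \<in> J; y \<in> J; x * y \<in> J\<rbrakk> \<Longrightarrow> K (x * y) = K x + K y"
    and meas: "K \<in> borel_measurable (lebesgue_on I)"
  shows "\<exists>\<beta>. \<forall>x\<in>J. K x = \<beta> * ln x"
proof -
  have "1 \<in> J"
    using I interior_subset by blast
  \<comment> \<open>An interval containing 1 and some \<open>x \<le> 0\<close> would contain 0.
    Positivity makes every point of \<open>J\<close> of the form \<open>exp u\<close>.\<close>
  have pos: "0 < x" if "x \<in> J" for x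
    using mem_is_interval_1_I[OF J(1) that \<open>1 \<in> J\<close>, of 0] J(2) by force
  have "open (exp -` interior I :: real set)"
    by (intro open_vimage continuous_intros) auto
  then have "0 \<in> interior (exp -` interior I :: real set)"
    using I(3) by (simp add: interior_open)
  then obtain d where d: "0 < d" "{0-d<..<0+d} \<subseteq> (exp -` interior I :: real set)"
    by (rule interior_real_Ioo)
  then have dI: "exp ` {-d<..<d} \<subseteq> I"
    using interior_subset by auto
  have "is_interval (exp -` J :: real set)"
    using J(1) unfolding is_interval_1 vimage_eq by (blast intro: exp_le_cancel_iff[THEN iffD2])
  moreover have "{-d<..<d} \<subseteq> exp -` J"
    using dI I(2) by blast
  moreover have "additive_on (exp -` J) (\<lambda>u. K (exp u))"
    using mult by (auto simp: additive_on_def exp_add)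
  moreover have "(\<lambda>u. K (exp u)) \<in> borel_measurable (lebesgue_on {-d<..<d})"
    using I(1) _ dI meas by (rule borel_measurable_lebesgue_on_comp_exp) simp
  ultimately obtain \<beta> where \<beta>: "\<And>u. u \<in> exp -` J \<Longrightarrow> K (exp u) = \<beta> * u"
    using additive_on_measurable_linear d(1) by blast
  have "K x = \<beta> * ln x" if "x \<in> J" for x
    using \<beta>[of "ln x"] pos[OF that] that by simp
  then show ?thesis by blast
qed

section \<open>The two equivalences\<close>

theorem theorem11:
  shows
   "(\<forall>(I :: real set) (J :: real set) (K :: real \<Rightarrow> real).
       is_interval I \<and> is_interval J \<and> I \<subseteq> J \<and> 0 \<in> interior I \<and> 0 \<in> interior J \<longrightarrow>
       (let mult_eq = (\<forall>x y. x \<in> J \<and> y \<in> J \<and> x + y \<in> J \<longrightarrow> K (x + y) = K x * K y);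
            A1 = (K \<in> borel_measurable (lebesgue_on I) \<and> mult_eq);
            A2 = (continuous_on I K \<and> mult_eq);
            A3 = ((\<forall>x\<in>J. K x = 0) \<or> (\<exists>\<beta>::real. \<forall>x\<in>J. K x = exp (\<beta> * x)))
        in (A1 \<longleftrightarrow> A2) \<and> (A2 \<longleftrightarrow> A3))) \<and>
    (\<forall>(I :: real set) (J :: real set) (K :: real \<Rightarrow> real).
       is_interval I \<and> is_interval J \<and> I \<subseteq> J \<and> 1 \<in> interior I \<and> 1 \<in> interior J \<longrightarrow>
       (let log_eq = (\<forall>x y. x \<in> J \<and> y \<in> J \<and> x * y \<in> J \<longrightarrow> K (x * y) = K x + K y);
            B1 = (K \<in> borel_measurable (lebesgue_on I) \<and> log_eq);
            B2 = (continuous_on I K \<and> log_eq);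
            B3 = ((0 \<in> J \<and> (\<forall>x\<in>J. K x = 0)) \<or>
                  (0 \<notin> J \<and> (\<exists>\<beta>::real. \<forall>x\<in>J. K x = \<beta> * ln x)))
        in (B1 \<longleftrightarrow> B2) \<and> (B2 \<longleftrightarrow> B3)))"
proof (intro conjI allI impI; elim conjE)
  fix I J :: "real set" and K :: "real \<Rightarrow> real"
  assume IJ: "is_interval I" "is_interval J" "I \<subseteq> J" "0 \<in> interior I"
  define P where "P \<longleftrightarrow> (\<forall>x y. x \<in> J \<and> y \<in> J \<and> x + y \<in> J \<longrightarrow> K (x + y) = K x * K y)"
  define Q where "Q \<longleftrightarrow> (\<forall>x\<in>J. K x = 0) \<or> (\<exists>\<beta>::real. \<forall>x\<in>J. K x = exp (\<beta> * x))"
  \<comment> \<open>The equivalences come from the cycle measurable, explicit form, continuous,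
    measurable. The last link is that a continuous function on a Lebesgue set is measurable
    there.\<close>
  have "Q" if "K \<in> borel_measurable (lebesgue_on I)" "P"
  proof -
    obtain d where d: "0 < d" "{-d<..<d} \<subseteq> I"
      using interior_real_Ioo[OF IJ(4)] by auto
    show ?thesis
      unfolding Q_def
    proof (rule multiplicative_measurable_exp[OF IJ(2) d(1)])
      show "{-d<..<d} \<subseteq> J"
        using d IJ(3) by blast
      show "K \<in> borel_measurable (lebesgue_on {-d<..<d})"
        using that(1) d(2) by (rule borel_measurable_lebesgue_on_subset)
    qed (use that(2) P_def in blast)
  qed
  moreover have "continuous_on I K \<and> P" if "Q"
    using that unfolding Q_def
  proof (elim disjE exE)
    assume 0: "\<forall>x\<in>J. K x = 0"
    then have "continuous_on I K \<longleftrightarrow> continuous_on I (\<lambda>x. 0 :: real)"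
      using IJ(3) by (intro continuous_on_cong) auto
    with 0 show ?thesis
      by (auto simp: P_def)
  next
    fix \<beta> assume \<beta>: "\<forall>x\<in>J. K x = exp (\<beta> * x)"
    then have "continuous_on I K \<longleftrightarrow> continuous_on I (\<lambda>x. exp (\<beta> * x))"
      using IJ(3) by (intro continuous_on_cong) auto
    moreover have "continuous_on I (\<lambda>x. exp (\<beta> * x))"
      by (intro continuous_intros)
    ultimately show ?thesis
      using \<beta> by (auto simp: P_def exp_add distrib_left)
  qed
  moreover have "K \<in> borel_measurable (lebesgue_on I)" if "continuous_on I K"
    using that interval_sets_lebesgue[OF IJ(1)] by (rule continuous_imp_measurable_on_sets_lebesgue)
  ultimately show "let mult_eq = (\<forall>x y. x \<in> J \<and> y \<in> J \<and> x + y \<in> J \<longrightarrow> K (x + y) = K x * K y);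
            A1 = (K \<in> borel_measurable (lebesgue_on I) \<and> mult_eq);
            A2 = (continuous_on I K \<and> mult_eq);
            A3 = ((\<forall>x\<in>J. K x = 0) \<or> (\<exists>\<beta>::real. \<forall>x\<in>J. K x = exp (\<beta> * x)))
        in (A1 \<longleftrightarrow> A2) \<and> (A2 \<longleftrightarrow> A3)"
    unfolding Let_def P_def[symmetric] Q_def[symmetric] by blast
next
  fix I J :: "real set" and K :: "real \<Rightarrow> real"
  assume IJ: "is_interval I" "is_interval J" "I \<subseteq> J" "1 \<in> interior I"
  define P where "P \<longleftrightarrow> (\<forall>x y. x \<in> J \<and> y \<in> J \<and> x * y \<in> J \<longrightarrow> K (x * y) = K x + K y)"
  define Q where "Q \<longleftrightarrow> (0 \<in> J \<and> (\<forall>x\<in>J. K x = 0)) \<or>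
                  (0 \<notin> J \<and> (\<exists>\<beta>::real. \<forall>x\<in>J. K x = \<beta> * ln x))"
  have I: "I \<in> sets lebesgue"
    using IJ(1) by (rule interval_sets_lebesgue)
  \<comment> \<open>The same cycle as for the exponential equation, now split by whether 0 lies in
    \<open>J\<close>.\<close>
  have "Q" if "K \<in> borel_measurable (lebesgue_on I)" "P"
  proof (cases "0 \<in> J")
    case True
    \<comment> \<open>Multiplying by 0 gives \<open>K 0 = K 0 + K x\<close>.\<close>
    have "K x = 0" if "x \<in> J" for x
      using \<open>P\<close>[unfolded P_def, rule_format, of 0 x] True that by simp
    with True show ?thesis
      by (simp add: Q_def)
  next
    case False
    have "\<exists>\<beta>. \<forall>x\<in>J. K x = \<beta> * ln x"
      by (rule logarithmic_measurable_ln[OF IJ(2) False I IJ(3,4) _ that(1)])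
        (use that(2) P_def in blast)
    with False show ?thesis
      by (simp add: Q_def)
  qed
  moreover have "continuous_on I K \<and> P" if "Q"
    using that unfolding Q_def
  proof (elim disjE exE conjE)
    assume 0: "\<forall>x\<in>J. K x = 0"
    then have "continuous_on I K \<longleftrightarrow> continuous_on I (\<lambda>x. 0 :: real)"
      using IJ(3) by (intro continuous_on_cong) auto
    with 0 show ?thesis
      by (auto simp: P_def)
  next
    fix \<beta> assume \<beta>: "\<forall>x\<in>J. K x = \<beta> * ln x" and "0 \<notin> J"
    have "1 \<in> J"
      using IJ(3,4) interior_subset by blast
    \<comment> \<open>Positivity of the points of \<open>J\<close> gives both the continuity of
      \<open>ln\<close> on \<open>I\<close> and the product rule for \<open>ln\<close>.\<close>
    have pos: "0 < x" if "x \<in> J" for x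
      using mem_is_interval_1_I[OF IJ(2) that \<open>1 \<in> J\<close>, of 0] \<open>0 \<notin> J\<close> by force
    have "continuous_on I K \<longleftrightarrow> continuous_on I (\<lambda>x. \<beta> * ln x)"
      using IJ(3) \<beta> by (intro continuous_on_cong) auto
    moreover have "continuous_on I (\<lambda>x. \<beta> * ln x)"
      using pos IJ(3) by (intro continuous_intros) force
    ultimately show ?thesis
      using \<beta> pos by (auto simp: P_def ln_mult_pos distrib_left)
  qed
  moreover have "K \<in> borel_measurable (lebesgue_on I)" if "continuous_on I K"
    using that I by (rule continuous_imp_measurable_on_sets_lebesgue)
  ultimately show "let log_eq = (\<forall>x y. x \<in> J \<and> y \<in> J \<and> x * y \<in> J \<longrightarrow> K (x * y) = K x + K y);
            B1 = (K \<in> borel_measurable (lebesgue_on I) \<and> log_eq);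
            B2 = (continuous_on I K \<and> log_eq);
            B3 = ((0 \<in> J \<and> (\<forall>x\<in>J. K x = 0)) \<or>
                  (0 \<notin> J \<and> (\<exists>\<beta>::real. \<forall>x\<in>J. K x = \<beta> * ln x)))
        in (B1 \<longleftrightarrow> B2) \<and> (B2 \<longleftrightarrow> B3)"
    unfolding Let_def P_def[symmetric] Q_def[symmetric] by blast
qed

end
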